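(* Let $P$ be an $n$-element poset, and let $\mathcal M$ be the set of maximal elements of $P$. For each $x\in\mathcal M$, let $\mathscr C_x$ be the number of chains of $P$ that contain $x$. Then the number of sortable labelings of $P$ is \[\sum_{x\in\mathcal M}\mathscr C_x\,|\mathcal L(P\setminus\{x\})|.\]
   Context: A labeling of an $n$-element poset $P$ is a bijection $L:P\to[n]$; $\mathcal L(R)$ denotes the set of linear extensions of a finite poset $R$ (bijections $L:R\to[|R|]$ with $L(x)\le L(y)$ whenever $x\le_R y$), and $P\setminus\{x\}$ is the induced subposet. A chain is a totally ordered subset. For a labeling $L$ and a non-maximal $x$, the $L$-successor of $x$ is the element $y>_P x$ minimizing $L(y)$. The promotion chain of $L$ is $v_1<_P\cdots<_P v_m$ with $v_1=L^{-1}(1)$, $v_{i+1}$ the $L$-successor of $v_i$ while $v_i$ is not maximal, and $v_m$ maximal. Extended promotion: $\partial(L)(x)=L(x)-1$ for $x$ not in the chain, $\partial(L)(v_i)=L(v_{i+1})-1$ for $i<m$, $\partial(L)(v_m)=n$. A labeling $L$ is sortable if $\partial(L)$ is a linear extension of $P$. *)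

theory Defs
  imports Main "HOL-Library.FuncSet"
begin

text \<open>
  A finite poset is a carrier \<^term>\<open>P\<close> with a relation \<^term>\<open>r\<close> such that
  \<^term>\<open>partial_order_on P r\<close>, which includes \<^term>\<open>r \<subseteq> P \<times> P\<close>. The subposet induced on
  \<^term>\<open>Q\<close> is \<^term>\<open>Q\<close> with \<^term>\<open>Restr r Q\<close>.
\<close>

text \<open>Labelings are extensional, so that counting them counts functions with domain \<^term>\<open>P\<close>.\<close>

definition labelings :: "'a set \<Rightarrow> ('a \<Rightarrow> nat) set" where
  "labelings P = {L \<in> extensional P. bij_betw L P {1..card P}}"

definition linear_extensions :: "'a set \<Rightarrow> 'a rel \<Rightarrow> ('a \<Rightarrow> nat) set" where
  "linear_extensions P r = {L \<in> labelings P. \<forall>x\<in>P. \<forall>y\<in>P. (x, y) \<in> r \<longrightarrow> L x \<le> L y}"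

definition maximal_elements :: "'a set \<Rightarrow> 'a rel \<Rightarrow> 'a set" where
  "maximal_elements P r = {x \<in> P. \<forall>y\<in>P. (x, y) \<in> r \<longrightarrow> y = x}"

definition chains_containing :: "'a set \<Rightarrow> 'a rel \<Rightarrow> 'a \<Rightarrow> 'a set set" where
  "chains_containing P r x = {C. C \<subseteq> P \<and> C \<in> Chains r \<and> x \<in> C}"

definition label_successor :: "'a set \<Rightarrow> 'a rel \<Rightarrow> ('a \<Rightarrow> nat) \<Rightarrow> 'a \<Rightarrow> 'a" where
  "label_successor P r L x = arg_min_on L {y \<in> P. (x, y) \<in> r \<and> y \<noteq> x}"

definition is_promotion_chain :: "'a set \<Rightarrow> 'a rel \<Rightarrow> ('a \<Rightarrow> nat) \<Rightarrow> 'a list \<Rightarrow> bool" where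
  "is_promotion_chain P r L vs \<longleftrightarrow>
     vs \<noteq> [] \<and>
     hd vs = inv_into P L 1 \<and>
     (\<forall>i. Suc i < length vs \<longrightarrow>
        vs ! i \<notin> maximal_elements P r \<and> vs ! Suc i = label_successor P r L (vs ! i)) \<and>
     last vs \<in> maximal_elements P r"

definition promotion_chain :: "'a set \<Rightarrow> 'a rel \<Rightarrow> ('a \<Rightarrow> nat) \<Rightarrow> 'a list" where
  "promotion_chain P r L = (THE vs. is_promotion_chain P r L vs)"

text \<open>
  For \<^term>\<open>x\<close> in the chain but not its last element, the next element of the chain is
  \<^term>\<open>label_successor P r L x\<close>; see \<open>promotion_nth\<close> below.
\<close>

definition promotion :: "'a set \<Rightarrow> 'a rel \<Rightarrow> ('a \<Rightarrow> nat) \<Rightarrow> 'a \<Rightarrow> nat" where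
  "promotion P r L = (\<lambda>x\<in>P.
     if x \<notin> set (promotion_chain P r L) then L x - 1
     else if x = last (promotion_chain P r L) then card P
     else L (label_successor P r L x) - 1)"

definition sortable_labelings :: "'a set \<Rightarrow> 'a rel \<Rightarrow> ('a \<Rightarrow> nat) set" where
  "sortable_labelings P r = {L \<in> labelings P. promotion P r L \<in> linear_extensions P r}"

lemma label_successor_mem:
  assumes "finite P" "partial_order_on P r" "x \<in> P" "x \<notin> maximal_elements P r"
  shows "label_successor P r L x \<in> P" "(x, label_successor P r L x) \<in> r"
    "label_successor P r L x \<noteq> x"
proof -
  let ?S = "{y \<in> P. (x, y) \<in> r \<and> y \<noteq> x}"
  have "?S \<noteq> {}" using assms(3,4) unfolding maximal_elements_def by blast
  moreover have "finite ?S" using assms(1) by simp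
  ultimately have "arg_min_on L ?S \<in> ?S" by (rule arg_min_if_finite(1)[rotated])
  then show "label_successor P r L x \<in> P" "(x, label_successor P r L x) \<in> r"
    "label_successor P r L x \<noteq> x"
    unfolding label_successor_def by auto
qed

lemma promotion_chain_from:
  assumes fin: "finite P" and po: "partial_order_on P r" and "x \<in> P"
  shows "\<exists>vs. vs \<noteq> [] \<and> hd vs = x \<and>
     (\<forall>i. Suc i < length vs \<longrightarrow>
        vs ! i \<notin> maximal_elements P r \<and> vs ! Suc i = label_successor P r L (vs ! i)) \<and>
     last vs \<in> maximal_elements P r"
  using \<open>x \<in> P\<close>
proof (induction "card {y \<in> P. (x, y) \<in> r}" arbitrary: x rule: less_induct)
  case less
  show ?case
  proof (cases "x \<in> maximal_elements P r")
    case True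
    then show ?thesis by (intro exI[of _ "[x]"]) auto
  next
    case False
    define z where "z = label_successor P r L x"
    have z: "z \<in> P" "(x, z) \<in> r" "z \<noteq> x"
      using label_successor_mem[OF fin po less.prems False] unfolding z_def by auto
    have tr: "trans r" and an: "antisym r" and rf: "refl_on P r"
      using po unfolding partial_order_on_def preorder_on_def by auto
    have "{y \<in> P. (z, y) \<in> r} \<subseteq> {y \<in> P. (x, y) \<in> r}"
      using tr z(2) by (auto dest: transD)
    moreover have "x \<in> {y \<in> P. (x, y) \<in> r}" using rf less.prems by (auto dest: refl_onD)
    moreover have "x \<notin> {y \<in> P. (z, y) \<in> r}" using an z by (auto dest: antisymD)
    ultimately have "{y \<in> P. (z, y) \<in> r} \<subset> {y \<in> P. (x, y) \<in> r}" by blast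
    then have "card {y \<in> P. (z, y) \<in> r} < card {y \<in> P. (x, y) \<in> r}"
      using fin by (intro psubset_card_mono) auto
    from less.hyps[OF this z(1)] obtain vs where vs: "vs \<noteq> []" "hd vs = z"
      "\<forall>i. Suc i < length vs \<longrightarrow>
        vs ! i \<notin> maximal_elements P r \<and> vs ! Suc i = label_successor P r L (vs ! i)"
      "last vs \<in> maximal_elements P r" by blast
    have "(x # vs) ! i \<notin> maximal_elements P r \<and>
        (x # vs) ! Suc i = label_successor P r L ((x # vs) ! i)"
      if "Suc i < length (x # vs)" for i
    proof (cases i)
      case 0
      then show ?thesis using False vs(1,2) by (simp add: z_def hd_conv_nth)
    next
      case (Suc j)
      then show ?thesis using vs(3) that by auto
    qed
    then show ?thesis using vs by (intro exI[of _ "x # vs"]) auto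
  qed
qed

lemma is_promotion_chain_unique:
  assumes vs: "is_promotion_chain P r L vs" and ws: "is_promotion_chain P r L ws"
  shows "vs = ws"
proof -
  have ind: "vs ! i = ws ! i" if "i < length vs" "i < length ws" for i
    using that
  proof (induction i)
    case 0
    then show ?case using vs ws by (simp add: is_promotion_chain_def hd_conv_nth)
  next
    case (Suc i)
    then show ?case using vs ws by (simp add: is_promotion_chain_def)
  qed
  have le: "length xs \<le> length ys"
    if xs: "is_promotion_chain P r L xs" and ys: "is_promotion_chain P r L ys"
      and eq: "\<And>i. i < length xs \<Longrightarrow> i < length ys \<Longrightarrow> xs ! i = ys ! i" for xs ys
  proof (rule ccontr)
    assume "\<not> length xs \<le> length ys"
    then have lt: "length ys < length xs" by simp
    have ne: "ys \<noteq> []" using ys by (simp add: is_promotion_chain_def)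
    then have "xs ! (length ys - 1) = last ys"
      using eq[of "length ys - 1"] lt by (simp add: last_conv_nth)
    moreover have "last ys \<in> maximal_elements P r" using ys by (simp add: is_promotion_chain_def)
    moreover have "xs ! (length ys - 1) \<notin> maximal_elements P r"
      using xs lt ne by (simp add: is_promotion_chain_def)
    ultimately show False by simp
  qed
  have "length vs = length ws" using le[OF vs ws] le[OF ws vs] ind by (metis le_antisym)
  then show ?thesis using ind by (simp add: list_eq_iff_nth_eq)
qed

lemma is_promotion_chain_promotion_chain:
  assumes "finite P" "P \<noteq> {}" "partial_order_on P r" "L \<in> labelings P"
  shows "is_promotion_chain P r L (promotion_chain P r L)"
proof -
  have "1 \<in> L ` P"
    using assms by (auto simp: labelings_def bij_betw_def Suc_le_eq card_gt_0_iff)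
  then have "inv_into P L 1 \<in> P" by (rule inv_into_into)
  from promotion_chain_from[OF assms(1,3) this, of L] obtain vs where
    vs: "is_promotion_chain P r L vs" unfolding is_promotion_chain_def by blast
  then show ?thesis
    unfolding promotion_chain_def by (rule theI) (rule is_promotion_chain_unique[OF _ vs])
qed

lemma promotion_chain_subset:
  assumes "finite P" "P \<noteq> {}" "partial_order_on P r" "L \<in> labelings P"
  shows "set (promotion_chain P r L) \<subseteq> P"
proof -
  let ?vs = "promotion_chain P r L"
  have pc: "is_promotion_chain P r L ?vs" by (rule is_promotion_chain_promotion_chain[OF assms])
  have "1 \<in> L ` P"
    using assms by (auto simp: labelings_def bij_betw_def Suc_le_eq card_gt_0_iff)
  then have 1: "inv_into P L 1 \<in> P" by (rule inv_into_into)
  have "?vs ! i \<in> P" if "i < length ?vs" for i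
    using that
  proof (induction i)
    case 0
    then show ?case using pc 1 by (simp add: is_promotion_chain_def hd_conv_nth)
  next
    case (Suc i)
    then have "?vs ! i \<in> P" "?vs ! i \<notin> maximal_elements P r"
      "?vs ! Suc i = label_successor P r L (?vs ! i)"
      using pc by (simp_all add: is_promotion_chain_def)
    then show ?case using label_successor_mem(1)[OF assms(1,3)] by simp
  qed
  then show ?thesis by (auto simp: in_set_conv_nth)
qed

lemma promotion_nth:
  assumes "finite P" "P \<noteq> {}" "partial_order_on P r" "L \<in> labelings P"
    and i: "Suc i < length (promotion_chain P r L)"
  shows "promotion P r L (promotion_chain P r L ! i) = L (promotion_chain P r L ! Suc i) - 1"
proof -
  let ?vs = "promotion_chain P r L"
  have pc: "is_promotion_chain P r L ?vs"
    by (rule is_promotion_chain_promotion_chain[OF assms(1-4)])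
  have "?vs ! i \<noteq> last ?vs" using pc i unfolding is_promotion_chain_def by metis
  moreover have "?vs ! i \<in> set ?vs" using i by simp
  moreover have "?vs ! i \<in> P" using calculation promotion_chain_subset[OF assms(1-4)] by blast
  moreover have "?vs ! Suc i = label_successor P r L (?vs ! i)"
    using pc i by (simp add: is_promotion_chain_def)
  ultimately show ?thesis by (simp add: promotion_def)
qed

end

theory Submission
  imports Defs "HOL-Combinatorics.Cycles"
begin

text \<open>
  Let \<open>\<tau>\<close> be the cyclic permutation \<open>v\<^sub>1 \<mapsto> v\<^sub>2 \<mapsto> \<dots> \<mapsto> v\<^sub>m \<mapsto> v\<^sub>1\<close> along the promotion chain of \<open>L\<close>,
  and let \<open>M\<close> be the promotion of \<open>L\<close>. The definition of promotion says exactly that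
  \<open>L (\<tau> x) = M x mod n + 1\<close>, so \<open>L\<close> can be recovered from \<open>M\<close> and the chain. Conversely, if \<open>M\<close> is a
  linear extension with \<open>M x = n\<close>, then for every chain through \<open>x\<close> this formula defines a
  labeling \<open>L\<close>, and since \<open>M\<close> increases along \<open>r\<close>, the promotion chain of \<open>L\<close> is the given one.
  Hence sortable labelings correspond to pairs of a linear extension of \<open>P\<close> and a chain
  containing the element \<open>x\<close> with label \<open>n\<close>; the former amounts to a linear extension of \<open>P - {x}\<close>.
\<close>

section \<open>Cycles along a list, and the cyclic shift of labels\<close>

lemma cycle_of_list_nth:
  assumes "distinct vs" "Suc i < length vs"
  shows "cycle_of_list vs (vs ! i) = vs ! Suc i"
proof -
  have "map (cycle_of_list vs) vs ! i = rotate1 vs ! i"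
    using cyclic_rotation[OF assms(1), of 1] by simp
  then show ?thesis
    using assms(2) by (simp add: nth_rotate1)
qed

lemma cycle_of_list_last:
  assumes "distinct vs" "vs \<noteq> []"
  shows "cycle_of_list vs (last vs) = hd vs"
proof -
  have "map (cycle_of_list vs) vs ! (length vs - 1) = rotate1 vs ! (length vs - 1)"
    using cyclic_rotation[OF assms(1), of 1] by simp
  then show ?thesis
    using assms(2) by (simp add: nth_rotate1 last_conv_nth hd_conv_nth)
qed

lemma mod_inj_on_atLeastAtMost: "inj_on (\<lambda>k. k mod n) {1..n::nat}"
proof (rule inj_onI)
  fix a b assume "a \<in> {1..n}" "b \<in> {1..n}" "a mod n = b mod n"
  then show "a = b"
    by (cases "a = n"; cases "b = n") auto
qed

text \<open>\<open>Suc (k mod n)\<close> sends \<open>n\<close> to \<open>1\<close> and any other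
  label \<open>k\<close> to \<open>k + 1\<close>. It thus undoes the decrement in extended
  promotion, with label \<open>n\<close> at the end of the chain wrapping round to label
  \<open>1\<close> at its head.\<close>

lemma bij_betw_Suc_mod:
  assumes "n \<ge> 1"
  shows "bij_betw (\<lambda>k. Suc (k mod n)) {1..n} {1..n}"
proof -
  have "inj_on (Suc \<circ> (\<lambda>k. k mod n)) {1..n}"
    by (intro comp_inj_on mod_inj_on_atLeastAtMost) simp
  then have inj: "inj_on (\<lambda>k. Suc (k mod n)) {1..n}" by (simp only: o_def)
  moreover have "(\<lambda>k. Suc (k mod n)) ` {1..n} \<subseteq> {1..n}"
    using assms by (auto simp: Suc_le_eq)
  ultimately show ?thesis
    using endo_inj_surj[of "{1..n}"] by (intro bij_betw_imageI) auto
qed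

lemma labelings_range:
  assumes "L \<in> labelings P" "x \<in> P"
  shows "1 \<le> L x" "L x \<le> card P"
  using assms bij_betwE[of L P "{1..card P}"] by (auto simp: labelings_def)

lemma labelings_inj_on: "L \<in> labelings P \<Longrightarrow> inj_on L P"
  by (auto simp: labelings_def bij_betw_def)

lemma linear_extensions_strict_mono:
  assumes "M \<in> linear_extensions P r" "x \<in> P" "y \<in> P" "(x, y) \<in> r" "x \<noteq> y"
  shows "M x < M y"
proof -
  have "M x \<le> M y" "M x \<noteq> M y"
    using assms labelings_inj_on[of M P] by (auto simp: linear_extensions_def inj_on_eq_iff)
  then show ?thesis by simp
qed

section \<open>The promotion chain and extended promotion of a labeling\<close>

locale finite_nonempty_poset =
  fixes P :: "'a set" and r :: "'a rel"
  assumes fin: "finite P" and nonempty: "P \<noteq> {}" and po: "partial_order_on P r"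
begin

lemma trans: "trans r" and antisym: "antisym r" and refl: "refl_on P r"
  using po by (auto simp: partial_order_on_def preorder_on_def)

lemma card_pos: "card P \<ge> 1"
  using fin nonempty by (simp add: Suc_le_eq card_gt_0_iff)

lemmas promotion_chain_spec = is_promotion_chain_promotion_chain[OF fin nonempty po]

text \<open>Each step goes to a strictly larger element, and antisymmetry makes the strict order
  transitive, so consecutive comparisons suffice. Distinctness of the list follows, which is what
  makes \<open>cycle_of_list\<close> rotate it.\<close>

lemma promotion_chain_strictly_increasing:
  assumes L: "L \<in> labelings P"
  shows "sorted_wrt (\<lambda>x y. (x, y) \<in> r \<and> x \<noteq> y) (promotion_chain P r L)"
proof -
  let ?vs = "promotion_chain P r L"
  have "transp (\<lambda>x y. (x, y) \<in> r \<and> x \<noteq> y)"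
    using trans antisym by (intro transpI) (meson antisymD transD)
  moreover have "(?vs ! i, ?vs ! Suc i) \<in> r \<and> ?vs ! i \<noteq> ?vs ! Suc i" if "Suc i < length ?vs" for i
  proof -
    have "?vs ! i \<in> P"
      using promotion_chain_subset[OF fin nonempty po L] that by auto
    then show ?thesis
      using label_successor_mem[OF fin po, of "?vs ! i" L] promotion_chain_spec[OF L] that
      by (auto simp: is_promotion_chain_def)
  qed
  ultimately show ?thesis
    by (simp add: sorted_wrt_iff_nth_Suc_transp)
qed

lemma distinct_promotion_chain:
  assumes "L \<in> labelings P"
  shows "distinct (promotion_chain P r L)"
  using promotion_chain_strictly_increasing[OF assms]
  by (auto simp: sorted_wrt_iff_nth_less distinct_conv_nth neq_iff) metis

lemma promotion_chain_in_chains: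
  assumes "L \<in> labelings P"
  shows "set (promotion_chain P r L) \<in> Chains r"
  unfolding Chains_def
proof (clarsimp simp: in_set_conv_nth)
  let ?vs = "promotion_chain P r L"
  fix i j assume ij: "i < length ?vs" "j < length ?vs" "(?vs ! j, ?vs ! i) \<notin> r"
  have "?vs ! i \<in> P"
    using promotion_chain_subset[OF fin nonempty po assms] ij by auto
  then show "(?vs ! i, ?vs ! j) \<in> r"
    using promotion_chain_strictly_increasing[OF assms] ij refl
    by (metis (mono_tags, lifting) linorder_neqE_nat refl_onD sorted_wrt_nth_less)
qed

lemma label_hd_promotion_chain:
  assumes "L \<in> labelings P"
  shows "L (hd (promotion_chain P r L)) = 1"
proof -
  have "1 \<in> L ` P"
    using assms card_pos by (auto simp: labelings_def bij_betw_def)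
  then show ?thesis
    using promotion_chain_spec[OF assms] by (simp add: is_promotion_chain_def f_inv_into_f)
qed

lemma promotion_last:
  assumes "L \<in> labelings P"
  shows "promotion P r L (last (promotion_chain P r L)) = card P"
proof -
  have "promotion_chain P r L \<noteq> []"
    using promotion_chain_spec[OF assms] by (simp add: is_promotion_chain_def)
  moreover from this have "last (promotion_chain P r L) \<in> P"
    using promotion_chain_subset[OF fin nonempty po assms] by auto
  ultimately show ?thesis
    by (simp add: promotion_def)
qed

text \<open>Turns the three cases of the definition of promotion into one equation. The range
  statement belongs with it: residues modulo \<open>card P\<close> determine a promotion value only
  within \<open>{1..card P}\<close>.\<close>

lemma promotion_range_and_shift:
  assumes L: "L \<in> labelings P" and x: "x \<in> P"
  shows "promotion P r L x \<in> {1..card P} \<and>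
    L (cycle_of_list (promotion_chain P r L) x) = Suc (promotion P r L x mod card P)"
proof -
  let ?vs = "promotion_chain P r L"
  have ne: "?vs \<noteq> []"
    using promotion_chain_spec[OF L] by (simp add: is_promotion_chain_def)
  have sub: "set ?vs \<subseteq> P"
    by (rule promotion_chain_subset[OF fin nonempty po L])
  \<comment> \<open>Label \<open>1\<close> sits at the head of the chain only, so
    \<open>L y - 1\<close> is nowhere else truncated to \<open>0\<close>.\<close>
  have not_one: "1 < L y" if "y \<in> P" "y \<noteq> hd ?vs" for y
  proof -
    have "hd ?vs \<in> P" using sub ne by auto
    then have "L y \<noteq> 1"
      using that label_hd_promotion_chain[OF L] inj_on_eq_iff[OF labelings_inj_on[OF L]] by metis
    then show ?thesis using labelings_range(1)[OF L that(1)] by simp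
  qed
  consider "x \<notin> set ?vs" | "x = last ?vs" | i where "Suc i < length ?vs" "x = ?vs ! i"
  proof (cases "x \<in> set ?vs")
    case True
    then obtain i where i: "i < length ?vs" "x = ?vs ! i" by (auto simp: in_set_conv_nth)
    show ?thesis
    proof (cases "Suc i < length ?vs")
      case True
      then show ?thesis using i that(3) by blast
    next
      case False
      then have "i = length ?vs - 1" using i by simp
      then show ?thesis using i that(2) ne by (simp add: last_conv_nth)
    qed
  qed (use that in blast)
  then show ?thesis
  proof cases
    case 1
    then have "1 < L x" using not_one[OF x] hd_in_set[OF ne] by metis
    moreover have "promotion P r L x = L x - 1" using 1 x by (simp add: promotion_def)
    moreover have "L x - 1 < card P" using labelings_range[OF L x] by linarith
    ultimately show ?thesis using 1 by (simp add: id_outside_supp)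
  next
    \<comment> \<open>Here the promotion value \<open>card P\<close> has residue \<open>0\<close>,
      which gives label \<open>1\<close>, and the cycle returns to the head, where \<open>L\<close>
      is \<open>1\<close>.\<close>
    case 2
    then show ?thesis
      using promotion_last[OF L] label_hd_promotion_chain[OF L] card_pos
        cycle_of_list_last[OF distinct_promotion_chain[OF L] ne] by simp
  next
    case (3 i)
    let ?y = "?vs ! Suc i"
    have y: "?y \<in> P" using 3 sub by auto
    have "?y \<noteq> hd ?vs"
      using distinct_promotion_chain[OF L] ne 3 by (simp add: hd_conv_nth nth_eq_iff_index_eq)
    then have "1 < L ?y" using not_one y by blast
    moreover have "L ?y - 1 < card P" using labelings_range[OF L y] by linarith
    moreover have "promotion P r L x = L ?y - 1"
      using promotion_nth[OF fin nonempty po L] 3 by simp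
    ultimately show ?thesis
      using cycle_of_list_nth[OF distinct_promotion_chain[OF L]] 3 by simp
  qed
qed

section \<open>Injectivity: recovering the labeling\<close>

lemma labeling_determined:
  assumes L: "L \<in> labelings P" and L': "L' \<in> labelings P"
    and chain: "promotion_chain P r L = promotion_chain P r L'"
    and prom: "promotion P r L = promotion P r L'"
  shows "L = L'"
proof (rule extensionalityI)
  let ?vs = "promotion_chain P r L"
  show "L \<in> extensional P" "L' \<in> extensional P"
    using L L' by (auto simp: labelings_def)
  fix y assume "y \<in> P"
  moreover have "cycle_of_list ?vs permutes P"
    using cycle_permutes promotion_chain_subset[OF fin nonempty po L] by (rule permutes_subset)
  \<comment> \<open>Every \<open>y\<close> is the image of some \<open>x\<close> under the cycle,
    and the shift equation at \<open>x\<close> expresses both labels of \<open>y\<close> through the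
    common promotion value.\<close>
  ultimately obtain x where "x \<in> P" "y = cycle_of_list ?vs x"
    by (metis imageE permutes_image)
  then show "L y = L' y"
    using promotion_range_and_shift[OF L] promotion_range_and_shift[OF L'] chain prom by simp
qed

text \<open>The chain need only be known as a set: the common promotion is a linear extension, so it
  increases along both chain lists, and sorting the set by it gives the list back.\<close>

lemma sortable_labeling_determined:
  assumes L: "L \<in> sortable_labelings P r" and L': "L' \<in> sortable_labelings P r"
    and chain: "set (promotion_chain P r L) = set (promotion_chain P r L')"
    and prom: "promotion P r L = promotion P r L'"
  shows "L = L'"
proof -
  let ?M = "promotion P r L"
  have lab: "L \<in> labelings P" "L' \<in> labelings P" and M: "?M \<in> linear_extensions P r"
    using L L' by (auto simp: sortable_labelings_def)
  have sorted: "sorted_wrt (<) (map ?M (promotion_chain P r K))" if K: "K \<in> labelings P" for K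
    using promotion_chain_strictly_increasing[OF K]
  proof (rule sorted_wrt_map_mono)
    fix x y assume "x \<in> set (promotion_chain P r K)" "y \<in> set (promotion_chain P r K)"
      "(x, y) \<in> r \<and> x \<noteq> y"
    then show "?M x < ?M y"
      using linear_extensions_strict_mono[OF M] promotion_chain_subset[OF fin nonempty po K]
      by blast
  qed
  have "inj_on ?M (set (promotion_chain P r L) \<union> set (promotion_chain P r L'))"
    using M labelings_inj_on[of ?M P] chain promotion_chain_subset[OF fin nonempty po lab(2)]
    by (auto simp: linear_extensions_def intro: inj_on_subset)
  then have "promotion_chain P r L = promotion_chain P r L'"
    by (rule map_sorted_distinct_set_unique)
      (use sorted[OF lab(1)] sorted[OF lab(2)] chain in \<open>auto simp: strict_sorted_iff\<close>)
  then show ?thesis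
    using labeling_determined[OF lab] prom by blast
qed

section \<open>Surjectivity: a labeling from a chain and a linear extension\<close>

lemma chain_sorted_by_linear_extension:
  assumes C: "C \<in> Chains r" "C \<subseteq> P" and M: "M \<in> linear_extensions P r"
  obtains vs where "set vs = C" "distinct vs"
    "\<And>i j. i < j \<Longrightarrow> j < length vs \<Longrightarrow> M (vs ! i) < M (vs ! j) \<and> (vs ! i, vs ! j) \<in> r"
proof -
  obtain us where us: "set us = C" "distinct us"
    using finite_distinct_list finite_subset[OF C(2) fin] by blast
  define vs where "vs = sort_key M us"
  have vs: "set vs = C" "distinct vs" using us by (simp_all add: vs_def)
  have inj: "inj_on M C"
    using M labelings_inj_on[of M P] C(2) by (auto simp: linear_extensions_def intro: inj_on_subset)
  have "sorted_wrt (<) (map M vs)"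
    using inj vs by (simp add: strict_sorted_iff distinct_map) (simp add: vs_def)
  then have less: "M (vs ! i) < M (vs ! j)" if "i < j" "j < length vs" for i j
    using that by (simp add: sorted_wrt_map sorted_wrt_iff_nth_less)
  moreover have "(vs ! i, vs ! j) \<in> r" if "i < j" "j < length vs" for i j
  proof -
    have mem: "vs ! i \<in> C" "vs ! j \<in> C" using that vs by auto
    \<comment> \<open>Elements of a chain are comparable, and the comparison in the other direction
      would contradict the order of their \<open>M\<close>-labels.\<close>
    moreover have "(vs ! j, vs ! i) \<notin> r"
      using less[OF that] M mem C(2) by (fastforce simp: linear_extensions_def)
    ultimately show ?thesis using C(1) by (auto simp: Chains_def)
  qed
  ultimately show thesis using that vs by blast
qed

lemma exists_sortable_labeling:
  assumes C: "C \<in> chains_containing P r x" and M: "M \<in> linear_extensions P r"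
    and Mx: "M x = card P"
  shows "\<exists>L \<in> sortable_labelings P r. last (promotion_chain P r L) = x \<and>
    set (promotion_chain P r L) = C \<and> promotion P r L = M"
proof -
  let ?n = "card P"
  have C': "C \<in> Chains r" "C \<subseteq> P" "x \<in> C" using C by (auto simp: chains_containing_def)
  have Mlab: "M \<in> labelings P" using M by (simp add: linear_extensions_def)
  obtain vs where vs: "set vs = C" "distinct vs"
    and inc: "\<And>i j. i < j \<Longrightarrow> j < length vs \<Longrightarrow> M (vs ! i) < M (vs ! j) \<and> (vs ! i, vs ! j) \<in> r"
    using chain_sorted_by_linear_extension[OF C'(1,2) M] by blast
  have ne: "vs \<noteq> []" using vs C'(3) by auto
  have memP: "vs ! i \<in> P" if "i < length vs" for i using that vs C'(2) by auto
  have last: "last vs = x"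
  proof -
    obtain i where i: "i < length vs" "x = vs ! i"
      using C'(3) vs by (auto simp: in_set_conv_nth)
    \<comment> \<open>No element of the list can follow \<open>x\<close>, since its label would
      exceed \<open>card P\<close>.\<close>
    have "\<not> i < length vs - 1"
      using inc[of i "length vs - 1"] i Mx labelings_range(2)[OF Mlab memP, of "length vs - 1"]
      by fastforce
    then have "i = length vs - 1" using i by simp
    then show ?thesis using i ne by (simp add: last_conv_nth)
  qed
  have below: "M y < ?n" if "y \<in> P" "y \<noteq> x" for y
  proof -
    have "M y \<noteq> M x"
      using that C' labelings_inj_on[OF Mlab] by (auto dest: inj_onD)
    then show ?thesis using labelings_range(2)[OF Mlab that(1)] Mx by simp
  qed
  define t where "t = cycle_of_list vs"
  have t: "t permutes P"
    unfolding t_def using cycle_permutes by (rule permutes_subset) (use vs C' in simp)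
  \<comment> \<open>Solves the shift equation \<open>L (t y) = Suc (M y mod ?n)\<close> for
    \<open>L\<close> by inverting the cycle.\<close>
  define L where "L = restrict ((\<lambda>k. Suc (k mod ?n)) \<circ> M \<circ> inv t) P"
  have "bij_betw ((\<lambda>k. Suc (k mod ?n)) \<circ> M \<circ> inv t) P {1..?n}"
    using permutes_imp_bij[OF permutes_inv[OF t]] Mlab bij_betw_Suc_mod[OF card_pos]
    by (intro bij_betw_trans) (auto simp: labelings_def)
  then have L: "L \<in> labelings P"
    unfolding labelings_def L_def by (auto simp: bij_betw_restrict_eq)
  have shift: "L (t y) = Suc (M y mod ?n)" if "y \<in> P" for y
    using that permutes_in_image[OF t] permutes_inverses(2)[OF t] by (simp add: L_def)
  have L_hd: "L (hd vs) = 1"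
    using shift[of x] cycle_of_list_last[OF vs(2) ne] C' last Mx by (auto simp: t_def)
  have L_Suc: "L (vs ! Suc i) = Suc (M (vs ! i))" if "Suc i < length vs" for i
  proof -
    \<comment> \<open>Before the end of the list the \<open>M\<close>-label is below
      \<open>?n\<close>, so the residue does not wrap round.\<close>
    have "vs ! i \<noteq> x"
      using that vs(2) ne last by (auto simp: last_conv_nth nth_eq_iff_index_eq)
    then show ?thesis
      using shift[OF memP, of i] below[OF memP, of i] that cycle_of_list_nth[OF vs(2) that]
      by (simp add: t_def)
  qed
  have succ: "vs ! Suc i = label_successor P r L (vs ! i)" if i: "Suc i < length vs" for i
  proof -
    let ?v = "vs ! i"
    \<comment> \<open>The next list element has label \<open>M ?v + 1\<close>. An element
      \<open>y\<close> off the list has label \<open>M y + 1\<close>, and one on the list has the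
      label of its predecessor plus one; that predecessor is \<open>?v\<close> or a later
      entry.\<close>
    have "L (vs ! Suc i) \<le> L y" if y: "y \<in> P" "(?v, y) \<in> r" "y \<noteq> ?v" for y
    proof -
      have Mless: "M ?v < M y"
        using linear_extensions_strict_mono[OF M memP y(1,2)] y(3) i by auto
      show ?thesis
      proof (cases "y \<in> set vs")
        case True
        then obtain j where j: "j < length vs" "y = vs ! j" by (auto simp: in_set_conv_nth)
        have "i < j"
          using Mless inc[of j i] i j by (metis Suc_lessD linorder_neqE_nat order_less_asym)
        then obtain k where k: "j = Suc k" "i \<le> k" by (cases j) auto
        then have "M ?v \<le> M (vs ! k)"
          using inc[of i k] j by (cases "i = k") auto
        then show ?thesis using L_Suc[OF i] L_Suc[of k] j k by simp
      next
        case False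
        then have "y \<noteq> x" using C' vs by auto
        then have "L y = Suc (M y)"
          using shift[OF y(1)] below[OF y(1)] False by (simp add: t_def id_outside_supp)
        then show ?thesis using L_Suc[OF i] Mless by simp
      qed
    qed
    moreover have "vs ! Suc i \<in> P" "(?v, vs ! Suc i) \<in> r" "vs ! Suc i \<noteq> ?v"
      using inc[of i "Suc i"] i memP by auto
    \<comment> \<open>Injectivity makes the minimizer unique, so \<open>arg_min\<close> must pick
      \<open>vs ! Suc i\<close>. The set is written in the shape to which \<open>arg_min_on\<close>
      unfolds.\<close>
    moreover have "inj_on L {y. y \<in> {y \<in> P. (?v, y) \<in> r \<and> y \<noteq> ?v}}"
      using labelings_inj_on[OF L] by (rule inj_on_subset) auto
    ultimately show ?thesis
      unfolding label_successor_def arg_min_on_def by (intro arg_min_inj_eq[symmetric]) auto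
  qed
  have not_max: "vs ! i \<notin> maximal_elements P r" if i: "Suc i < length vs" for i
    using inc[of i "Suc i"] i memP[of "Suc i"] by (auto simp: maximal_elements_def)
  have "x \<in> maximal_elements P r"
  proof -
    \<comment> \<open>An element strictly above \<open>x\<close> would need an
      \<open>M\<close>-label larger than \<open>card P\<close>.\<close>
    have "y = x" if "y \<in> P" "(x, y) \<in> r" for y
      using linear_extensions_strict_mono[OF M _ that] below[OF that(1)] Mx C' by fastforce
    then show ?thesis using C' by (auto simp: maximal_elements_def)
  qed
  moreover have "hd vs = inv_into P L 1"
    using inv_into_f_eq[OF labelings_inj_on[OF L] _ L_hd] hd_in_set[OF ne] vs C' by auto
  ultimately have "is_promotion_chain P r L vs"
    using succ not_max ne last by (simp add: is_promotion_chain_def)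
  then have pc: "promotion_chain P r L = vs"
    using is_promotion_chain_unique promotion_chain_spec[OF L] by blast
  have "promotion P r L = M"
  proof (rule extensionalityI)
    show "promotion P r L \<in> extensional P" "M \<in> extensional P"
      using Mlab by (auto simp: promotion_def labelings_def)
    fix y assume y: "y \<in> P"
    \<comment> \<open>\<open>L\<close> satisfies the shift equation both for \<open>M\<close> and
      for its own promotion, so the two agree modulo \<open>?n\<close>; as both lie in
      \<open>{1..?n}\<close>, they are equal.\<close>
    have "promotion P r L y mod ?n = M y mod ?n" "promotion P r L y \<in> {1..?n}"
      using promotion_range_and_shift[OF L y] shift[OF y] pc by (auto simp: t_def)
    then show "promotion P r L y = M y"
      by (rule inj_onD[OF mod_inj_on_atLeastAtMost]) (use labelings_range[OF Mlab y] in simp)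
  qed
  then show ?thesis
    using L M pc vs last by (auto simp: sortable_labelings_def)
qed

section \<open>Counting the triples\<close>

lemma finite_linear_extensions: "finite (linear_extensions P r)"
proof (rule finite_subset)
  show "linear_extensions P r \<subseteq> P \<rightarrow>\<^sub>E {1..card P}"
    by (auto simp: linear_extensions_def labelings_def PiE_def bij_betw_def)
  show "finite (P \<rightarrow>\<^sub>E {1..card P})"
    using fin by (intro finite_PiE) auto
qed

text \<open>Removing \<open>x\<close> together with the top label leaves the labels
  \<open>{1..card P - 1}\<close> on the rest. Conversely, putting the top label on \<open>x\<close>
  respects the order because nothing lies strictly above a maximal element.\<close>

lemma bij_betw_linear_extensions_remove:
  assumes x: "x \<in> maximal_elements P r"
  shows "bij_betw (\<lambda>M. restrict M (P - {x})) {M \<in> linear_extensions P r. M x = card P}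
    (linear_extensions (P - {x}) (Restr r (P - {x})))"
proof (rule bij_betwI')
  have xP: "x \<in> P" using x by (simp add: maximal_elements_def)
  have card: "card (P - {x}) = card P - 1" using fin xP by simp
  have ins: "{1..card P} - {card P} = {1..card P - 1}" by auto
  fix M assume M: "M \<in> {M \<in> linear_extensions P r. M x = card P}"
  {
    fix M' assume M': "M' \<in> {M \<in> linear_extensions P r. M x = card P}"
    show "(restrict M (P - {x}) = restrict M' (P - {x})) = (M = M')"
    proof
      assume eq: "restrict M (P - {x}) = restrict M' (P - {x})"
      show "M = M'"
      proof (rule extensionalityI)
        show "M \<in> extensional P" "M' \<in> extensional P"
          using M M' by (auto simp: linear_extensions_def labelings_def)
        show "M y = M' y" if "y \<in> P" for y
          using M M' that fun_cong[OF eq, of y] by (cases "y = x") auto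
      qed
    qed simp
  }
  have "bij_betw M (P - {x}) ({1..card P} - {M x})"
    using M xP bij_betw_DiffI[of M P "{1..card P}" "{x}" "{M x}"] card_pos
    by (auto simp: linear_extensions_def labelings_def)
  then show "restrict M (P - {x}) \<in> linear_extensions (P - {x}) (Restr r (P - {x}))"
    using M card ins by (auto simp: linear_extensions_def labelings_def)
next
  have xP: "x \<in> P" using x by (simp add: maximal_elements_def)
  have card: "card (P - {x}) = card P - 1" using fin xP by simp
  fix K assume K: "K \<in> linear_extensions (P - {x}) (Restr r (P - {x}))"
  then have Kbij: "bij_betw K (P - {x}) {1..card P - 1}" and Kext: "K \<in> extensional (P - {x})"
    using card by (auto simp: linear_extensions_def labelings_def)
  define M where "M = K(x := card P)"
  have "bij_betw M (P - {x}) {1..card P - 1}"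
    using Kbij bij_betw_cong[of "P - {x}" M K] by (simp add: M_def)
  then have "bij_betw M (insert x (P - {x})) (insert (M x) {1..card P - 1})"
    using card_pos by (intro bij_betw_combine[of M "{x}" "{M x}", simplified]) (auto simp: M_def)
  moreover have "insert x (P - {x}) = P" using xP by auto
  moreover have "insert (M x) {1..card P - 1} = {1..card P}" using card_pos by (auto simp: M_def)
  moreover have "M \<in> extensional P" using Kext xP by (auto simp: M_def extensional_def)
  ultimately have Mlab: "M \<in> labelings P" by (simp add: labelings_def)
  have "M y \<le> M z" if yz: "y \<in> P" "z \<in> P" "(y, z) \<in> r" for y z
  proof (cases "z = x")
    case True
    then show ?thesis using labelings_range(2)[OF Mlab yz(1)] by (simp add: M_def)
  next
    case False
    \<comment> \<open>Only here does maximality matter for the order: with \<open>y = x\<close> it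
      would force \<open>z = x\<close>.\<close>
    then have "y \<noteq> x" using x yz by (auto simp: maximal_elements_def)
    then show ?thesis using K yz False by (auto simp: M_def linear_extensions_def)
  qed
  then have "M \<in> {M \<in> linear_extensions P r. M x = card P}"
    using Mlab by (auto simp: linear_extensions_def M_def)
  moreover have "K = restrict M (P - {x})"
    using Kext by (auto simp: M_def extensional_def restrict_def)
  ultimately show "\<exists>M\<in>{M \<in> linear_extensions P r. M x = card P}. K = restrict M (P - {x})"
    by blast
qed

text \<open>The last chain element is recorded as the index of a \<open>SIGMA\<close> set, because
  the admissible chains and linear extensions both depend on it; for a fixed index they vary
  independently, hence the product in each summand.\<close>

lemma bij_betw_sortable_labelings:
  "bij_betw
    (\<lambda>L. (last (promotion_chain P r L), set (promotion_chain P r L), promotion P r L))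
    (sortable_labelings P r)
    (SIGMA x:maximal_elements P r.
      chains_containing P r x \<times> {M \<in> linear_extensions P r. M x = card P})"
  (is "bij_betw ?F _ ?B")
proof (rule bij_betw_imageI)
  show "inj_on ?F (sortable_labelings P r)"
    using sortable_labeling_determined by (intro inj_onI) auto
  have "?F L \<in> ?B" if "L \<in> sortable_labelings P r" for L
  proof -
    have L: "L \<in> labelings P" "promotion P r L \<in> linear_extensions P r"
      using that by (auto simp: sortable_labelings_def)
    then show ?thesis
      using promotion_chain_spec[OF L(1)] promotion_last[OF L(1)]
        promotion_chain_in_chains[OF L(1)] promotion_chain_subset[OF fin nonempty po L(1)]
      by (auto simp: is_promotion_chain_def chains_containing_def)
  qed
  moreover have "b \<in> ?F ` sortable_labelings P r" if "b \<in> ?B" for b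
    using that exists_sortable_labeling by (auto simp: image_iff) metis
  ultimately show "?F ` sortable_labelings P r = ?B"
    by blast
qed

lemma card_sortable_labelings:
  "card (sortable_labelings P r) =
    (\<Sum>x\<in>maximal_elements P r. card (chains_containing P r x) *
      card (linear_extensions (P - {x}) (Restr r (P - {x}))))"
proof -
  have "finite (maximal_elements P r)"
    using fin by (auto simp: maximal_elements_def)
  moreover have "finite (chains_containing P r x)" for x
    using fin by (auto simp: chains_containing_def intro: finite_subset[of _ "Pow P"])
  ultimately have "card (sortable_labelings P r) =
    (\<Sum>x\<in>maximal_elements P r. card (chains_containing P r x) *
      card {M \<in> linear_extensions P r. M x = card P})"
    using bij_betw_same_card[OF bij_betw_sortable_labelings] finite_linear_extensions
    by (simp add: card_SigmaI card_cartesian_product)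
  then show ?thesis
    using bij_betw_same_card[OF bij_betw_linear_extensions_remove] by simp
qed

end

theorem theorem4p2:
  fixes P :: "'a set" and r :: "'a rel" and n :: nat
  assumes "finite P" and "partial_order_on P r" and "card P = n" and "n \<ge> 1"
  shows "card (sortable_labelings P r) =
    (\<Sum>x\<in>maximal_elements P r.
       card (chains_containing P r x) *
       card (linear_extensions (P - {x}) (Restr r (P - {x}))))"
proof -
  interpret finite_nonempty_poset P r
    using assms by unfold_locales auto
  show ?thesis by (rule card_sortable_labelings)
qed

end
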